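(* Let $S = \{ n \in \mathbb{N} \mid \exists\, x \in \mathbb{N} : x^2 \equiv n \pmod 6 \}$. Then the minimal set of $S$ is $$M(S) = \{ 1,3,4,6,7,9,22,25,28,52,55,58,82,85,88 \}.$$
   Context: $\mathbb{N}=\{1,2,3,\ldots\}$ denotes the positive integers. Each positive integer is identified with its usual base-10 digit string (without leading zeros). For positive integers $x,y$ write $x \triangleleft y$ if the digit string of $x$ is a subsequence (in order, not necessarily contiguous) of the digit string of $y$, i.e. either $x=y$ or $x$ is obtained from $y$ by deleting some digits of $y$ (for example $514 \triangleleft 352148$). For a set $S\subset\mathbb{N}$, the minimal set of $S$ is $$M(S) := \{ s\in S \mid \{ n\in S : n<s,\ n\triangleleft s\}=\varnothing \}.$$ *)

theory Defs
  imports "HOL-Library.Sublist" "HOL-Number_Theory.Cong"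
begin

(* Most significant digit first; no leading zeros for n > 0. *)
fun dec_digits :: "nat \<Rightarrow> nat list" where
  "dec_digits n = (if n < 10 then [n] else dec_digits (n div 10) @ [n mod 10])"

declare dec_digits.simps [simp del]

definition digit_subseq :: "nat \<Rightarrow> nat \<Rightarrow> bool"  (infix \<open>\<triangleleft>\<close> 50) where
  "x \<triangleleft> y \<longleftrightarrow> subseq (dec_digits x) (dec_digits y)"

(* Meant for sets of positive integers, so 0 must be excluded from S by the user. *)
definition minimal_set :: "nat set \<Rightarrow> nat set" where
  "minimal_set S = {s \<in> S. {n \<in> S. n < s \<and> n \<triangleleft> s} = {}}"

lemma "514 \<triangleleft> 352148"
  by (simp add: digit_subseq_def dec_digits.simps)

end

(* Squares modulo 6 are exactly the residues 0, 1, 3, 4, so S consists of the positive n that are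
   not congruent to 2 modulo 3, a condition on the digit sum. A number in S with no digit among
   1, 3, 4, 6, 7, 9 has only the digits 0, 2, 5, 8; a single nonzero digit would give digit sum
   2 modulo 3, so there are two, and any two of 2, 5, 8 form a number that is 1 modulo 3. *)
theory Submission
  imports Defs
begin

text \<open>Squares are 0 or 1 modulo 3, which gives one direction; for the other, \<open>n\<close>
  turns out to be its own square root modulo 6.\<close>

lemma square_residue_mod_6_iff:
  fixes n :: nat
  assumes "n > 0"
  shows "(\<exists>x>0. [x\<^sup>2 = n] (mod 6)) \<longleftrightarrow> n mod 3 \<noteq> 2"
proof
  assume "\<exists>x>0. [x\<^sup>2 = n] (mod 6)"
  then obtain x where "[x\<^sup>2 = n] (mod 6)" by blast
  then have "[x\<^sup>2 = n] (mod 3)"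
    by (rule cong_dvd_modulus_nat) simp
  then have "n mod 3 = (x mod 3)\<^sup>2 mod 3"
    by (simp add: cong_def power_mod)
  moreover have "x mod 3 \<in> {0, 1, 2}" by auto
  ultimately show "n mod 3 \<noteq> 2" by auto
next
  assume n: "n mod 3 \<noteq> 2"
  have "n mod 6 \<in> {0, 1, 3, 4}"
    using n by (simp, presburger)
  \<comment> \<open>The residues 0, 1, 3, 4 are exactly the idempotents modulo 6, so
    \<open>x = n\<close> is a witness.\<close>
  then have "(n mod 6)\<^sup>2 mod 6 = n mod 6" by auto
  then have "[n\<^sup>2 = n] (mod 6)" by (simp add: cong_def power_mod)
  then show "\<exists>x>0. [x\<^sup>2 = n] (mod 6)" using assms by blast
qed

text \<open>Casting out threes: 10 is 1 modulo 3, so the place of a digit does not matter.\<close>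

lemma sum_list_dec_digits_mod_3: "sum_list (dec_digits n) mod 3 = n mod 3"
proof (induction n rule: dec_digits.induct)
  case (1 n)
  show ?case
  proof (cases "n < 10")
    case True
    then show ?thesis by (simp add: dec_digits.simps[of n])
  next
    case False
    define q r where "q = n div 10" and "r = n mod 10"
    have "sum_list (dec_digits n) mod 3 = (sum_list (dec_digits q) + r) mod 3"
      using False by (simp add: dec_digits.simps[of n] q_def r_def)
    also have "\<dots> = (q + r) mod 3"
      using 1[OF False] by (intro mod_add_cong) (simp_all add: q_def)
    also have "\<dots> = (10 * q + r) mod 3" by presburger
    also have "10 * q + r = n" by (simp add: q_def r_def)
    finally show ?thesis .
  qed
qed

lemma dec_digits_less_10: "d \<in> set (dec_digits n) \<Longrightarrow> d < 10"
proof (induction n rule: dec_digits.induct)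
  case (1 n)
  then show ?case
    using dec_digits.simps[of n] by (cases "n < 10") auto
qed

lemma dec_digits_nonzero_digit:
  assumes "n > 0" shows "\<exists>d\<in>set (dec_digits n). d \<noteq> 0"
  using assms
proof (induction n rule: dec_digits.induct)
  case (1 n)
  then show ?case
    using dec_digits.simps[of n] by (cases "n < 10") auto
qed

text \<open>Horner evaluation inverts \<open>dec_digits\<close>, so numbers can be compared through
  their digit lists.\<close>

lemma foldl_dec_digits: "foldl (\<lambda>a d. 10 * a + d) 0 (dec_digits n) = n"
proof (induction n rule: dec_digits.induct)
  case (1 n)
  then show ?case
    using dec_digits.simps[of n] by (cases "n < 10") auto
qed

text \<open>Two accumulators are needed for the induction: a digit \<open>y\<close> skipped in
  \<open>ys\<close> turns \<open>b\<close> into \<open>10 * b + y\<close>, which is still at least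
  \<open>a\<close>, and a matched digit preserves \<open>a \<le> b\<close>.\<close>

lemma foldl_base_10_mono:
  fixes a b :: nat
  assumes "subseq xs ys" "a \<le> b"
  shows "foldl (\<lambda>a d. 10 * a + d) a xs \<le> foldl (\<lambda>a d. 10 * a + d) b ys"
  using assms
proof (induction arbitrary: a b rule: list_emb.induct)
  case (list_emb_Nil ys)
  then show ?case
  proof (induction ys arbitrary: b)
    case (Cons y ys)
    then show ?case using Cons.IH[of "10 * b + y"] by simp
  qed simp
qed auto

lemma digit_subseq_imp_le: "x \<triangleleft> y \<Longrightarrow> x \<le> y"
  unfolding digit_subseq_def
  using foldl_base_10_mono[of "dec_digits x" "dec_digits y" 0 0] by (simp add: foldl_dec_digits)

lemma digit_subseq_trans: "x \<triangleleft> y \<Longrightarrow> y \<triangleleft> z \<Longrightarrow> x \<triangleleft> z"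
  unfolding digit_subseq_def by (rule subseq_order.trans)

text \<open>As \<open>\<triangleleft>\<close> implies \<open>\<le>\<close>, the condition
  \<open>n < s\<close> in \<open>minimal_set\<close> only excludes \<open>n = s\<close>. If
  \<open>n \<triangleleft> s\<close> with \<open>n < s\<close>, some \<open>t\<close> in
  \<open>L\<close> lies below \<open>n\<close>; transitivity and the antichain property force
  \<open>t = s\<close>, hence \<open>s \<le> n\<close>, a contradiction.\<close>

lemma minimal_set_eq_antichain:
  assumes "L \<subseteq> S"
    and below: "\<And>n. n \<in> S \<Longrightarrow> \<exists>t\<in>L. t \<triangleleft> n"
    and antichain: "\<And>s t. s \<in> L \<Longrightarrow> t \<in> L \<Longrightarrow> t \<triangleleft> s \<Longrightarrow> t = s"
  shows "minimal_set S = L"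
proof (intro equalityI subsetI)
  fix s assume "s \<in> minimal_set S"
  then have s: "s \<in> S" and min: "\<And>n. n \<in> S \<Longrightarrow> n \<triangleleft> s \<Longrightarrow> \<not> n < s"
    by (auto simp: minimal_set_def)
  obtain t where "t \<in> L" "t \<triangleleft> s" using below s by blast
  moreover then have "t = s"
    using min[of t] digit_subseq_imp_le[of t s] assms(1) by auto
  ultimately show "s \<in> L" by simp
next
  fix s assume s: "s \<in> L"
  have False if n: "n \<in> S" "n < s" "n \<triangleleft> s" for n
  proof -
    obtain t where t: "t \<in> L" "t \<triangleleft> n" using below n by blast
    then have "t = s" using antichain s digit_subseq_trans n by blast
    then show False using digit_subseq_imp_le[of t n] t n by simp
  qed
  then show "s \<in> minimal_set S" using s assms(1) by (auto simp: minimal_set_def)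
qed

lemma digit_subseq_not_2_mod_3:
  assumes "n > 0" "n mod 3 \<noteq> 2"
  shows "\<exists>t\<in>{1, 3, 4, 6, 7, 9, 22, 25, 28, 52, 55, 58, 82, 85, 88}. t \<triangleleft> n"
proof (cases "\<exists>d\<in>set (dec_digits n). d \<in> {1, 3, 4, 6, 7, 9}")
  case True
  then obtain d where "d \<in> set (dec_digits n)" and d: "d \<in> {1, 3, 4, 6, 7, 9}" by blast
  moreover from this have "d < 10" by auto
  ultimately have "d \<triangleleft> n"
    by (simp add: digit_subseq_def dec_digits.simps[of d] subseq_singleton_left)
  then show ?thesis using d by blast
next
  case False
  \<comment> \<open>Dropping zeros keeps the digit sum and leaves a subsequence, so the first two
    entries of \<open>ds\<close> can serve as the digits of the required number.\<close>
  define ds where "ds = filter (\<lambda>d. d \<noteq> 0) (dec_digits n)"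
  have digits: "d \<in> {2, 5, 8}" if "d \<in> set ds" for d
  proof -
    have "d \<in> set (dec_digits n)" "d \<noteq> 0" using that by (auto simp: ds_def)
    moreover from this have "d < 10" using dec_digits_less_10 by blast
    moreover have "d \<notin> {1, 3, 4, 6, 7, 9}" using False calculation by blast
    ultimately show ?thesis by auto
  qed
  have "sum_list ds = sum_list (dec_digits n)"
    using sum_list_map_filter[of "dec_digits n" "\<lambda>d. d \<noteq> 0" "\<lambda>d. d"] by (auto simp: ds_def)
  then have sum: "sum_list ds mod 3 \<noteq> 2"
    using assms(2) sum_list_dec_digits_mod_3 by simp
  obtain a xs where "ds = a # xs"
    using dec_digits_nonzero_digit[OF assms(1)]
    by (cases ds) (auto simp: ds_def filter_empty_conv)
  moreover from this have "xs \<noteq> []" using sum digits[of a] by auto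
  ultimately obtain b ys where ds: "ds = a # b # ys" by (cases xs) auto
  have ab: "a \<in> {2, 5, 8}" "b \<in> {2, 5, 8}" using digits ds by auto
  \<comment> \<open>Here \<open>a\<close> is nonzero, so there is no leading zero.\<close>
  then have "dec_digits (10 * a + b) = [a, b]"
    using dec_digits.simps[of "10 * a + b"] dec_digits.simps[of a] by auto
  moreover have "subseq [a, b] ds" by (simp add: ds)
  moreover have "subseq ds (dec_digits n)" by (simp add: ds_def)
  ultimately have "10 * a + b \<triangleleft> n"
    unfolding digit_subseq_def by (metis subseq_order.trans)
  then show ?thesis
    by (rule bexI) (use ab in auto)
qed

theorem theorem2:
  fixes S :: "nat set"
  assumes "S = {n. n > 0 \<and> (\<exists>x>0. [x\<^sup>2 = n] (mod 6))}"
  shows "minimal_set S = {1, 3, 4, 6, 7, 9, 22, 25, 28, 52, 55, 58, 82, 85, 88}"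
proof (rule minimal_set_eq_antichain)
  have S: "S = {n. n > 0 \<and> n mod 3 \<noteq> 2}"
    using assms square_residue_mod_6_iff by auto
  show "{1, 3, 4, 6, 7, 9, 22, 25, 28, 52, 55, 58, 82, 85, 88} \<subseteq> S"
    unfolding S by simp
  show "\<exists>t\<in>{1, 3, 4, 6, 7, 9, 22, 25, 28, 52, 55, 58, 82, 85, 88}. t \<triangleleft> n" if "n \<in> S" for n
    using that digit_subseq_not_2_mod_3 unfolding S by blast
  fix s t :: nat
  assume "s \<in> {1, 3, 4, 6, 7, 9, 22, 25, 28, 52, 55, 58, 82, 85, 88}"
    and "t \<in> {1, 3, 4, 6, 7, 9, 22, 25, 28, 52, 55, 58, 82, 85, 88}"
    and "t \<triangleleft> s"
  \<comment> \<open>The 15 * 15 pairs are checked one by one by computing digit lists.\<close>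
  then show "t = s"
    by (elim insertE emptyE; hypsubst; simp add: digit_subseq_def dec_digits.simps)
qed

end
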